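(* Let $n \geq p \geq 1$ be integers. The number $F(n;p)$ of elements $\alpha \in \mathcal{ODDP}_n$ with $h(\alpha)=p$ is $$F(n;p)=\binom{n+1}{p+1}.$$
   Context: $X_n=\{1,2,\ldots,n\}$ and $\mathcal{I}_n$ is the symmetric inverse semigroup of all partial one-to-one maps of $X_n$ (including the empty map), with maps written on the right of their arguments. A map $\alpha\in\mathcal{I}_n$ is a partial isometry if $|x-y|=|x\alpha-y\alpha|$ for all $x,y\in\operatorname{Dom}\alpha$; it is order-decreasing if $x\alpha\leq x$ for all $x\in\operatorname{Dom}\alpha$; it is order-preserving if $x\leq y$ implies $x\alpha\leq y\alpha$ for all $x,y\in\operatorname{Dom}\alpha$. $\mathcal{ODDP}_n$ is the semigroup of all order-preserving, order-decreasing partial isometries of $X_n$. The height of $\alpha$ is $h(\alpha)=|\operatorname{Im}\alpha|$. *)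

theory Defs
  imports Complex_Main
begin

text \<open>Partial maps of \<open>{1..n}\<close> are represented by the library type \<open>nat \<rightharpoonup> nat\<close>, with
  \<open>dom\<close> as domain and \<open>ran\<close> as image.\<close>

definition sym_inv_semigroup :: "nat \<Rightarrow> (nat \<rightharpoonup> nat) set" where
  "sym_inv_semigroup n =
     {\<alpha>. dom \<alpha> \<subseteq> {1..n} \<and> ran \<alpha> \<subseteq> {1..n} \<and> inj_on \<alpha> (dom \<alpha>)}"

text \<open>The distance is taken in \<open>int\<close> because subtraction on \<open>nat\<close> truncates.\<close>

definition partial_isometry :: "(nat \<rightharpoonup> nat) \<Rightarrow> bool" where
  "partial_isometry \<alpha> \<longleftrightarrow>
     (\<forall>x\<in>dom \<alpha>. \<forall>y\<in>dom \<alpha>.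
        \<bar>int x - int y\<bar> = \<bar>int (the (\<alpha> x)) - int (the (\<alpha> y))\<bar>)"

definition order_decreasing :: "(nat \<rightharpoonup> nat) \<Rightarrow> bool" where
  "order_decreasing \<alpha> \<longleftrightarrow> (\<forall>x\<in>dom \<alpha>. the (\<alpha> x) \<le> x)"

definition order_preserving :: "(nat \<rightharpoonup> nat) \<Rightarrow> bool" where
  "order_preserving \<alpha> \<longleftrightarrow>
     (\<forall>x\<in>dom \<alpha>. \<forall>y\<in>dom \<alpha>. x \<le> y \<longrightarrow> the (\<alpha> x) \<le> the (\<alpha> y))"

definition ODDP :: "nat \<Rightarrow> (nat \<rightharpoonup> nat) set" where
  "ODDP n = {\<alpha> \<in> sym_inv_semigroup n.
     order_preserving \<alpha> \<and> order_decreasing \<alpha> \<and> partial_isometry \<alpha>}"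

definition height :: "(nat \<rightharpoonup> nat) \<Rightarrow> nat" where
  "height \<alpha> = card (ran \<alpha>)"

definition F :: "nat \<Rightarrow> nat \<Rightarrow> nat" where
  "F n p = card {\<alpha> \<in> ODDP n. height \<alpha> = p}"

end

theory Submission
  imports Defs
begin

text \<open>
  On a line, a distance-preserving map that also preserves the order is a translation, so a
  nonempty order-preserving, order-decreasing partial isometry has the form
  \<open>x \<mapsto> x - k\<close> on its domain \<open>A\<close>. The condition that its image lies in
  \<open>{1..n}\<close> says exactly that \<open>0 \<le> k\<close> is smaller than every element of \<open>A\<close>.
  The pair \<open>(k, A)\<close> is therefore the same thing as the set \<open>insert k A \<subseteq> {0..n}\<close> with its minimum
  \<open>k\<close> marked off. This identifies the maps of height \<open>p \<ge> 1\<close> with the \<open>(p + 1)\<close>-subsets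
  of the \<open>(n + 1)\<close>-element set \<open>{0..n}\<close>. The lemma \<open>ODDP_translation\<close> gives the translation form,
  and \<open>bij_betw_translation_of\<close> is the identification.
\<close>

definition translation :: "nat \<Rightarrow> nat set \<Rightarrow> (nat \<rightharpoonup> nat)" where
  "translation k A = (\<lambda>x. if x \<in> A then Some (x - k) else None)"

definition translation_of :: "nat set \<Rightarrow> (nat \<rightharpoonup> nat)" where
  "translation_of B = translation (Min B) (B - {Min B})"

lemma dom_translation [simp]: "dom (translation k A) = A"
  by (auto simp: translation_def dom_def split: if_splits)

lemma ran_translation: "ran (translation k A) = (\<lambda>x. x - k) ` A"
  by (auto simp: translation_def ran_def)

lemma translation_in_ODDP:
  assumes A: "A \<subseteq> {1..n}" and k: "\<And>x. x \<in> A \<Longrightarrow> k < x"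
  shows "translation k A \<in> ODDP n"
proof -
  have "ran (translation k A) \<subseteq> {1..n}"
    using A k by (fastforce simp: ran_translation)
  moreover have "inj_on (translation k A) A"
    using k by (auto simp: inj_on_def translation_def) (metis less_imp_le eq_diff_iff)
  moreover have "partial_isometry (translation k A)"
    using k unfolding partial_isometry_def
    by (auto simp: translation_def of_nat_diff less_imp_le)
  ultimately show ?thesis
    using A by (auto simp: ODDP_def sym_inv_semigroup_def order_preserving_def
        order_decreasing_def translation_def dom_def)
qed

lemma height_translation:
  assumes "\<And>x. x \<in> A \<Longrightarrow> k < x"
  shows "height (translation k A) = card A"
proof -
  have "inj_on (\<lambda>x. x - k) A"
    using assms by (intro inj_on_diff_nat) (simp add: less_imp_le)
  then show ?thesis
    by (simp add: height_def ran_translation card_image)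
qed

text \<open>
  Comparing any point of the domain with one fixed point \<open>a\<close>, monotonicity removes the absolute
  values from the isometry equation, so every point moves by the same amount as \<open>a\<close>. That the
  amount is a natural number is order-decrease at \<open>a\<close>; that it is smaller than every point is
  positivity of the image.
\<close>

lemma ODDP_translation:
  assumes \<alpha>: "\<alpha> \<in> ODDP n" and ne: "dom \<alpha> \<noteq> {}"
  obtains k where "\<alpha> = translation k (dom \<alpha>)" and "\<And>x. x \<in> dom \<alpha> \<Longrightarrow> k < x"
proof -
  obtain a where a: "a \<in> dom \<alpha>" using ne by blast
  define k where "k = a - the (\<alpha> a)"
  have img: "the (\<alpha> x) \<ge> 1" if "x \<in> dom \<alpha>" for x
    using \<alpha> that by (auto simp: ODDP_def sym_inv_semigroup_def ran_def)
  have "int x - int (the (\<alpha> x)) = int k" if x: "x \<in> dom \<alpha>" for x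
  proof -
    have "\<bar>int x - int a\<bar> = \<bar>int (the (\<alpha> x)) - int (the (\<alpha> a))\<bar>"
      using \<alpha> x a unfolding ODDP_def partial_isometry_def by blast
    moreover have "x \<le> a \<Longrightarrow> the (\<alpha> x) \<le> the (\<alpha> a)" "a \<le> x \<Longrightarrow> the (\<alpha> a) \<le> the (\<alpha> x)"
      using \<alpha> x a unfolding ODDP_def order_preserving_def by blast+
    moreover have "the (\<alpha> a) \<le> a"
      using \<alpha> a unfolding ODDP_def order_decreasing_def by blast
    ultimately show ?thesis unfolding k_def by linarith
  qed
  then have shift: "x = the (\<alpha> x) + k" if "x \<in> dom \<alpha>" for x
    using that by fastforce
  show thesis
  proof
    show "\<alpha> = translation k (dom \<alpha>)"
    proof
      fix x show "\<alpha> x = translation k (dom \<alpha>) x"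
        using shift[of x] by (cases "\<alpha> x") (auto simp: translation_def dom_def)
    qed
    show "k < x" if "x \<in> dom \<alpha>" for x
      using shift[OF that] img[OF that] by linarith
  qed
qed

text \<open>
  A set \<open>B\<close> is recovered from its map because the domain contains some point \<open>x\<close>, and \<open>x\<close> minus its
  image is \<open>Min B\<close>. This is where \<open>p \<ge> 1\<close> enters: all singletons give the empty map, which
  remembers no translation length.
\<close>

lemma bij_betw_translation_of:
  assumes p: "p \<ge> 1"
  shows "bij_betw translation_of {B. B \<subseteq> {0..n} \<and> card B = p + 1} {\<alpha> \<in> ODDP n. height \<alpha> = p}"
    (is "bij_betw _ ?S ?T")
proof -
  have fin: "finite B" and min_in: "Min B \<in> B" if "B \<in> ?S" for B
  proof -
    show "finite B" using that finite_subset by blast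
    then show "Min B \<in> B" using that by (intro Min_in) auto
  qed
  have above: "Min B < x" if "B \<in> ?S" "x \<in> B - {Min B}" for B x
    using that fin[OF that(1)] Min_le[of B x] by (auto simp: le_less)
  have card: "card (B - {Min B}) = p" if "B \<in> ?S" for B
    using that min_in[OF that] fin[OF that] by simp
  show ?thesis
  proof (rule bij_betw_imageI)
    show "inj_on translation_of ?S"
    proof (rule inj_onI)
      fix B C assume B: "B \<in> ?S" and C: "C \<in> ?S" and eq: "translation_of B = translation_of C"
      have dom: "B - {Min B} = C - {Min C}"
        using arg_cong[OF eq, of dom] by (simp add: translation_of_def)
      have "B - {Min B} \<noteq> {}"
        using card[OF B] p by (metis card.empty not_one_le_zero)
      then obtain x where x: "x \<in> B - {Min B}" by blast
      then have "x - Min B = x - Min C"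
        using fun_cong[OF eq, of x] dom by (auto simp: translation_of_def translation_def)
      moreover have "Min B < x" "Min C < x"
        using above[OF B] above[OF C] x dom by blast+
      ultimately have "Min B = Min C" by linarith
      then show "B = C"
        using dom min_in[OF B] min_in[OF C] by (metis insert_Diff)
    qed
    show "translation_of ` ?S = ?T"
    proof (intro equalityI subsetI)
      fix \<alpha> assume "\<alpha> \<in> translation_of ` ?S"
      then obtain B where B: "B \<in> ?S" and \<alpha>: "\<alpha> = translation_of B" by blast
      have "B - {Min B} \<subseteq> {1..n}"
      proof
        fix x assume x: "x \<in> B - {Min B}"
        then show "x \<in> {1..n}" using above[OF B x] B by auto
      qed
      then show "\<alpha> \<in> ?T"
        using translation_in_ODDP[OF _ above[OF B]] height_translation[OF above[OF B]] card[OF B]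
        unfolding \<alpha> translation_of_def by blast
    next
      fix \<alpha> assume \<alpha>: "\<alpha> \<in> ?T"
      then have ne: "dom \<alpha> \<noteq> {}"
        using p by (auto simp: height_def)
      obtain k where k: "\<alpha> = translation k (dom \<alpha>)" "\<And>x. x \<in> dom \<alpha> \<Longrightarrow> k < x"
        using ODDP_translation \<alpha> ne by blast
      have sub: "dom \<alpha> \<subseteq> {1..n}"
        using \<alpha> by (simp add: ODDP_def sym_inv_semigroup_def)
      then have fin: "finite (dom \<alpha>)" by (rule finite_subset) simp
      define B where "B = insert k (dom \<alpha>)"
      have notin: "k \<notin> dom \<alpha>" using k(2) by blast
      have min: "Min B = k"
        unfolding B_def using fin k(2) by (intro Min_eqI) (auto intro: less_imp_le)
      have "card (dom \<alpha>) = p"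
        using \<alpha> height_translation[of "dom \<alpha>" k] k by simp
      then have "card B = p + 1"
        using notin fin by (simp add: B_def)
      moreover have "B \<subseteq> {0..n}"
        using ne sub k(2) by (fastforce simp: B_def)
      moreover have "translation_of B = \<alpha>"
        using notin k(1) by (simp add: translation_of_def min) (simp add: B_def)
      ultimately show "\<alpha> \<in> translation_of ` ?S" by blast
    qed
  qed
qed

theorem proposition2p2:
  fixes n p :: nat
  assumes "n \<ge> p" and "p \<ge> 1"
  shows "F n p = (n + 1) choose (p + 1)"
proof -
  have "F n p = card {B. B \<subseteq> {0..n} \<and> card B = p + 1}"
    using bij_betw_same_card[OF bij_betw_translation_of[OF assms(2)]] by (simp add: F_def)
  also have "\<dots> = (n + 1) choose (p + 1)"
    using n_subsets[of "{0..n}" "p + 1"] by simp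
  finally show ?thesis .
qed

end
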